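(* All entire locally operator monotone functions are linear. That is, $$L(\mathbb{R}^n)=\{f \mid f(w)=x\cdot w,\ x\in(\mathbb{R}^{\ge0})^n\}.$$
   Context: For $U\subseteq\mathbb{R}^n$ open, a $C^1$ function $f:U\to\mathbb{R}$ is locally operator monotone on $U$ if $S'(t)\ge0\Rightarrow\frac{d}{dt}f(S(t))\ge0$ for every $C^1$ parametrized curve $S(t)$ in the set of commuting $n$-tuples of self-adjoint operators with joint spectrum $\sigma(S(t))\subset U$. $L(U)$ is the class of all locally operator monotone functions on $U$; entire means $U=\mathbb{R}^n$. $\mathbb{R}^{\ge0}=[0,\infty)$.
   Formalization: "Linear" is corrected to affine: L(R^n) = {x·w + c : x ≥ 0, c real}, because constant functions are locally operator monotone (their derivative is 0) but not of the form x·w. Operators are bounded, on an infinite-dimensional complex Hilbert space. *)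

theory Defs
  imports "HOL-Analysis.Analysis"
begin

(* Complex Hilbert spaces. The real structure (norm, topology, real inner product) is inherited
   from real_inner and complete_space, and the last two axioms tie it to the complex one.
   cinner is linear in its first argument. *)
class complex_hilbert_space = real_inner + complete_space +
  fixes scaleC :: "complex \<Rightarrow> 'a \<Rightarrow> 'a"  (infixr \<open>*\<^sub>C\<close> 75)
    and cinner :: "'a \<Rightarrow> 'a \<Rightarrow> complex"
  assumes scaleC_add_right: "c *\<^sub>C (x + y) = c *\<^sub>C x + c *\<^sub>C y"
    and scaleC_add_left: "(c + d) *\<^sub>C x = c *\<^sub>C x + d *\<^sub>C x"
    and scaleC_scaleC: "c *\<^sub>C (d *\<^sub>C x) = (c * d) *\<^sub>C x"
    and cinner_commute: "cinner x y = cnj (cinner y x)"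
    and cinner_add_left: "cinner (x + y) z = cinner x z + cinner y z"
    and cinner_scaleC_left: "cinner (c *\<^sub>C x) y = c * cinner x y"
    and scaleR_eq_scaleC: "r *\<^sub>R x = complex_of_real r *\<^sub>C x"
    and inner_eq_Re_cinner: "x \<bullet> y = Re (cinner x y)"

(* Bounded operators are elements of 'h \<Rightarrow>\<^sub>L 'h, which are a priori only real-linear. *)
definition complex_linear :: "('h::complex_hilbert_space \<Rightarrow>\<^sub>L 'h) \<Rightarrow> bool" where
  "complex_linear T \<longleftrightarrow> (\<forall>c x. T (c *\<^sub>C x) = c *\<^sub>C T x)"

definition self_adjoint :: "('h::complex_hilbert_space \<Rightarrow>\<^sub>L 'h) \<Rightarrow> bool" where
  "self_adjoint T \<longleftrightarrow> complex_linear T \<and> (\<forall>x y. cinner (T x) y = cinner x (T y))"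

(* T \<ge> 0; the quadratic form of a self-adjoint operator is real-valued. *)
definition positive_operator :: "('h::complex_hilbert_space \<Rightarrow>\<^sub>L 'h) \<Rightarrow> bool" where
  "positive_operator T \<longleftrightarrow> self_adjoint T \<and> (\<forall>x. 0 \<le> Re (cinner (T x) x))"

definition commuting_self_adjoint :: "('h::complex_hilbert_space \<Rightarrow>\<^sub>L 'h) ^ 'n \<Rightarrow> bool" where
  "commuting_self_adjoint S \<longleftrightarrow>
     (\<forall>i. self_adjoint (S $ i)) \<and> (\<forall>i j. S $ i o\<^sub>L S $ j = S $ j o\<^sub>L S $ i)"

(* \<lambda> lies outside the joint spectrum iff the operators S_i - \<lambda>_i generate the unit ideal. For
   commuting self-adjoint tuples left and right ideals give the same set (take adjoints), it
   agrees with the other usual notions of joint spectrum, and it contains only real points,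
   so it is taken inside real ^ 'n. *)
definition joint_spectrum ::
  "('h::complex_hilbert_space \<Rightarrow>\<^sub>L 'h) ^ 'n \<Rightarrow> (real ^ 'n::finite) set" where
  "joint_spectrum S = {l. \<not> (\<exists>B :: 'n \<Rightarrow> ('h \<Rightarrow>\<^sub>L 'h). (\<forall>i. complex_linear (B i)) \<and>
      (\<Sum>i\<in>UNIV. B i o\<^sub>L (S $ i - (l $ i) *\<^sub>R id_blinfun)) = id_blinfun)}"

(* \<Phi> is the continuous functional calculus of S: the contractive unital homomorphism from the
   real continuous functions on the joint spectrum to the self-adjoint operators that sends the
   i-th coordinate function to S_i. By contractivity \<Phi> g depends only on g restricted to the
   joint spectrum. *)
definition is_functional_calculus ::
  "('h::complex_hilbert_space \<Rightarrow>\<^sub>L 'h) ^ 'n::finite \<Rightarrow> ((real ^ 'n \<Rightarrow> real) \<Rightarrow> ('h \<Rightarrow>\<^sub>L 'h)) \<Rightarrow> bool"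
  where
  "is_functional_calculus S \<Phi> \<longleftrightarrow>
     (\<forall>g. continuous_on (joint_spectrum S) g \<longrightarrow>
        self_adjoint (\<Phi> g) \<and>
        (\<forall>M. (\<forall>x\<in>joint_spectrum S. \<bar>g x\<bar> \<le> M) \<longrightarrow> norm (\<Phi> g) \<le> M)) \<and>
     (\<forall>g h. continuous_on (joint_spectrum S) g \<longrightarrow> continuous_on (joint_spectrum S) h \<longrightarrow>
        \<Phi> (\<lambda>x. g x + h x) = \<Phi> g + \<Phi> h \<and>
        \<Phi> (\<lambda>x. g x * h x) = \<Phi> g o\<^sub>L \<Phi> h) \<and>
     (\<forall>c. \<Phi> (\<lambda>_. c) = c *\<^sub>R id_blinfun) \<and>
     (\<forall>i. \<Phi> (\<lambda>x. x $ i) = S $ i)"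

(* T = f(S). For commuting self-adjoint S and f continuous on the joint spectrum, exactly one
   such T exists: existence is the spectral theorem, uniqueness is Stone-Weierstrass. *)
definition is_function_of ::
  "(real ^ 'n::finite \<Rightarrow> real) \<Rightarrow> ('h::complex_hilbert_space \<Rightarrow>\<^sub>L 'h) ^ 'n \<Rightarrow> ('h \<Rightarrow>\<^sub>L 'h) \<Rightarrow> bool" where
  "is_function_of f S T \<longleftrightarrow> (\<exists>\<Phi>. is_functional_calculus S \<Phi> \<and> \<Phi> f = T)"

definition C1_function_on :: "(real ^ 'n::finite) set \<Rightarrow> (real ^ 'n \<Rightarrow> real) \<Rightarrow> bool" where
  "C1_function_on U f \<longleftrightarrow>
     (\<exists>G. continuous_on U G \<and> (\<forall>x\<in>U. (f has_derivative (\<lambda>h. G x \<bullet> h)) (at x)))"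

(* For U open. The curve S has an arbitrary open interval as its domain and is C^1 in operator
   norm; F is the curve t \<mapsto> f(S(t)). The implication is pointwise in t, and its conclusion
   includes the existence of the derivative of F at t. Values of f outside U play no role. *)
definition locally_operator_monotone_on ::
  "'h::complex_hilbert_space itself \<Rightarrow> (real ^ 'n::finite) set \<Rightarrow> (real ^ 'n \<Rightarrow> real) \<Rightarrow> bool" where
  "locally_operator_monotone_on H U f \<longleftrightarrow>
     C1_function_on U f \<and>
     (\<forall>a b (S :: real \<Rightarrow> ('h \<Rightarrow>\<^sub>L 'h) ^ 'n) F.
        S C1_differentiable_on {a<..<b} \<longrightarrow>
        (\<forall>t\<in>{a<..<b}. commuting_self_adjoint (S t) \<and> joint_spectrum (S t) \<subseteq> U) \<longrightarrow>
        (\<forall>t\<in>{a<..<b}. is_function_of f (S t) (F t)) \<longrightarrow>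
        (\<forall>t\<in>{a<..<b}. (\<forall>i. positive_operator (vector_derivative S (at t) $ i)) \<longrightarrow>
           (\<exists>D. (F has_vector_derivative D) (at t) \<and> positive_operator D)))"

definition L_class ::
  "'h::complex_hilbert_space itself \<Rightarrow> (real ^ 'n::finite) set \<Rightarrow> (real ^ 'n \<Rightarrow> real) set" where
  "L_class H U = {f. locally_operator_monotone_on H U f}"

end

theory Submission
  imports Defs "HOL-Real_Asymp.Real_Asymp"
begin

text \<open>
  Only curves of tuples with at most two joint eigenvalues are needed. Fix a point \<open>w\<close> and a direction
  \<open>v \<ge> 0\<close>, and let \<open>P t\<close> be the projection onto the unit vector \<open>cos t e1 + sin t e2\<close> of a fixed
  complex plane. The tuple \<open>S t\<close> with entries \<open>(w $ i + t v $ i) I + v $ i P t\<close> has joint eigenvalue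
  \<open>w + v + t v\<close> on the range of \<open>P t\<close> and \<open>w + t v\<close> on its complement, so that
  \<open>f (S t) = f (w + t v) I + (f (w + v + t v) - f (w + t v)) P t\<close>. The derivative of \<open>P\<close> at \<open>t\<close> is the
  difference of the two projections \<open>P (t + pi/4)\<close> and \<open>P (t - pi/4)\<close>, hence at least \<open>- I\<close>, and so
  \<open>S' \<ge> 0\<close>. Testing the positivity of the derivative of \<open>f (S t)\<close> at \<open>0\<close> on the plane gives the
  \<open>2\<close>-by-\<open>2\<close> Loewner inequality (\<open>loewner_form_nonneg\<close>). For \<open>g s = f (w + s v)\<close> it says that
  \<open>g' \<ge> 0\<close> and \<open>(g y - g x)\<^sup>2 \<le> (y - x)\<^sup>2 g' x g' y\<close>.

  On the whole real line this inequality leaves no room for curvature (\<open>affine_if_loewner_2\<close>). For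
  fixed \<open>y\<close> it is a Riccati inequality for \<open>g - g y\<close>, whose solutions blow up in finite time unless
  \<open>g x - g y \<le> g' y (x - y)\<close> for all \<open>x > y\<close>; reflection gives the mirror image. So the mean of
  \<open>g'\<close> over an interval is at most its value at either endpoint. Using this on both sides of a minimum
  of \<open>g'\<close> shows that \<open>g'\<close> is constant.

  Thus \<open>f\<close> is affine along every line in a nonnegative direction. The lines through the origin determine
  \<open>f\<close> on the nonnegative orthant, and a line in the direction \<open>(1, ..., 1)\<close> through any other point
  eventually stays inside that orthant, so the same formula holds everywhere
  (\<open>affine_if_affine_along_nonneg_directions\<close>).

  Conversely, an affine function of a tuple is the corresponding combination of its entries, and nonnegative
  coefficients preserve the positivity of the derivative.
\<close>

section \<open>Complex inner products\<close>

lemma cinner_add_right: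
  "cinner (x::'h::complex_hilbert_space) (y + z) = cinner x y + cinner x z"
  by (metis cinner_add_left cinner_commute complex_cnj_add)

lemma cinner_scaleC_right:
  "cinner (x::'h::complex_hilbert_space) (c *\<^sub>C y) = cnj c * cinner x y"
  by (metis cinner_scaleC_left cinner_commute complex_cnj_mult)

lemma cinner_scaleR_left:
  "cinner (r *\<^sub>R x :: 'h::complex_hilbert_space) y = of_real r * cinner x y"
  by (simp add: scaleR_eq_scaleC cinner_scaleC_left)

lemma cinner_scaleR_right:
  "cinner (x :: 'h::complex_hilbert_space) (r *\<^sub>R y) = of_real r * cinner x y"
  by (simp add: scaleR_eq_scaleC cinner_scaleC_right)

lemmas cinner_simps =
  cinner_add_left cinner_add_right cinner_scaleC_left cinner_scaleC_right
  cinner_scaleR_left cinner_scaleR_right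

lemma scaleC_scaleR_commute:
  "c *\<^sub>C (r *\<^sub>R x) = r *\<^sub>R (c *\<^sub>C x :: 'h::complex_hilbert_space)"
  by (simp add: scaleR_eq_scaleC scaleC_scaleC mult.commute)

lemma cinner_self: "cinner x x = of_real ((norm (x::'h::complex_hilbert_space))\<^sup>2)"
proof -
  have "Im (cinner x x) = 0"
    using arg_cong[OF cinner_commute[of x x], of Im] by simp
  moreover have "Re (cinner x x) = (norm x)\<^sup>2"
    by (simp add: inner_eq_Re_cinner[symmetric] power2_norm_eq_inner)
  ultimately show ?thesis by (simp add: complex_eq_iff)
qed

lemma scaleC_eq_scaleR:
  "c *\<^sub>C x = Re c *\<^sub>R x + Im c *\<^sub>R (\<i> *\<^sub>C x :: 'h::complex_hilbert_space)"
proof -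
  have "c *\<^sub>C x = (complex_of_real (Re c) + complex_of_real (Im c) * \<i>) *\<^sub>C x"
    by (rule arg_cong[where f = "\<lambda>c. c *\<^sub>C x"]) (simp add: complex_eq_iff)
  then show ?thesis
    by (simp only: scaleC_add_left scaleR_eq_scaleC scaleC_scaleC)
qed

text \<open>
  Writing the map \<open>x \<mapsto> cinner x b *\<^sub>C a\<close> with real inner products makes its boundedness a consequence of
  that of the real inner product.
\<close>
lemma cinner_scaleC_eq_inner:
  "cinner x b *\<^sub>C a = (x \<bullet> b) *\<^sub>R a + (x \<bullet> (\<i> *\<^sub>C b)) *\<^sub>R (\<i> *\<^sub>C a :: 'h::complex_hilbert_space)"
  by (subst scaleC_eq_scaleR) (simp add: inner_eq_Re_cinner cinner_scaleC_right)

text \<open>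
  Gram-Schmidt over the complex numbers. The span in the hypothesis is the real one, so the complex line
  through \<open>e1\<close> is spanned by \<open>e1\<close> and \<open>\<i> *\<^sub>C e1\<close>.
\<close>
lemma exists_orthonormal_pair:
  assumes "\<not> (\<exists>B :: 'h::complex_hilbert_space set. finite B \<and> span B = UNIV)"
  obtains e1 e2 :: "'h::complex_hilbert_space"
  where "cinner e1 e1 = 1" "cinner e2 e2 = 1" "cinner e1 e2 = 0" "cinner e2 e1 = 0"
proof -
  have normalize: "cinner (y /\<^sub>R norm y) (y /\<^sub>R norm y) = 1" if "y \<noteq> 0" for y :: 'h
    using that by (simp add: cinner_self)
  obtain y :: 'h where y: "y \<noteq> 0"
    using assms[unfolded not_ex, rule_format, of "{0}"] by auto
  define e1 where "e1 = y /\<^sub>R norm y"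
  have e1: "cinner e1 e1 = 1" unfolding e1_def by (rule normalize[OF y])
  have "span {e1, \<i> *\<^sub>C e1} \<noteq> UNIV"
    using assms[unfolded not_ex, rule_format, of "{e1, \<i> *\<^sub>C e1}"] by simp
  then obtain x where x: "x \<notin> span {e1, \<i> *\<^sub>C e1}" by blast
  define z where "z = x + (- cinner x e1) *\<^sub>C e1"
  have ze: "cinner z e1 = 0" by (simp add: z_def cinner_simps e1)
  have "z \<noteq> 0"
  proof
    assume "z = 0"
    have "x = z + cinner x e1 *\<^sub>C e1"
      by (simp add: z_def add.assoc scaleC_add_left[symmetric])
         (metis add.right_neutral scaleR_eq_scaleC of_real_0 scaleR_zero_left)
    also have "\<dots> = Re (cinner x e1) *\<^sub>R e1 + Im (cinner x e1) *\<^sub>R (\<i> *\<^sub>C e1)"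
      using \<open>z = 0\<close> scaleC_eq_scaleR[of "cinner x e1" e1] by simp
    also have "\<dots> \<in> span {e1, \<i> *\<^sub>C e1}"
      by (intro span_add span_scale span_base) auto
    finally show False using x by simp
  qed
  define e2 where "e2 = z /\<^sub>R norm z"
  have e2: "cinner e2 e2 = 1" unfolding e2_def by (rule normalize[OF \<open>z \<noteq> 0\<close>])
  have e21: "cinner e2 e1 = 0" by (simp add: e2_def cinner_scaleR_left ze)
  have "cinner e1 e2 = 0" by (subst cinner_commute) (simp add: e21)
  with e1 e2 e21 that show thesis by blast
qed

section \<open>Self-adjoint operators and orthogonal projections\<close>

lemma self_adjoint_id: "self_adjoint id_blinfun"
  by (simp add: self_adjoint_def complex_linear_def)

lemma self_adjoint_add: "self_adjoint A \<Longrightarrow> self_adjoint B \<Longrightarrow> self_adjoint (A + B)"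
  by (simp add: self_adjoint_def complex_linear_def blinfun.add_left cinner_simps scaleC_add_right)

lemma self_adjoint_scaleR: "self_adjoint A \<Longrightarrow> self_adjoint (r *\<^sub>R A)"
  by (simp add: self_adjoint_def complex_linear_def blinfun.scaleR_left cinner_simps
      scaleC_scaleR_commute)

lemma self_adjoint_diff:
  assumes "self_adjoint A" "self_adjoint B" shows "self_adjoint (A - B)"
  using self_adjoint_add[OF assms(1) self_adjoint_scaleR[OF assms(2), of "-1"]] by simp

lemma positive_operator_add:
  "positive_operator A \<Longrightarrow> positive_operator B \<Longrightarrow> positive_operator (A + B)"
  by (simp add: positive_operator_def self_adjoint_add blinfun.add_left cinner_simps)

lemma positive_operator_scaleR:
  "positive_operator A \<Longrightarrow> 0 \<le> r \<Longrightarrow> positive_operator (r *\<^sub>R A)"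
  by (simp add: positive_operator_def self_adjoint_scaleR blinfun.scaleR_left cinner_simps)

lemma positive_operator_0: "positive_operator 0"
  using self_adjoint_scaleR[OF self_adjoint_id, of 0]
  by (simp add: positive_operator_def inner_eq_Re_cinner[symmetric])

lemma positive_operator_sum:
  assumes "\<And>i. i \<in> I \<Longrightarrow> positive_operator (A i)"
  shows "positive_operator (\<Sum>i\<in>I. A i)"
  using assms
  by (induction I rule: infinite_finite_induct) (auto intro: positive_operator_0 positive_operator_add)

definition orthogonal_projection :: "('h::complex_hilbert_space \<Rightarrow>\<^sub>L 'h) \<Rightarrow> bool" where
  "orthogonal_projection P \<longleftrightarrow> self_adjoint P \<and> P o\<^sub>L P = P"

lemma orthogonal_projection_idem: "orthogonal_projection P \<Longrightarrow> P (P x) = P x"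
  by (metis blinfun_apply_blinfun_compose orthogonal_projection_def)

lemma positive_operator_projection:
  assumes "orthogonal_projection P"
  shows "positive_operator P"
proof -
  have "cinner (P x) x = cinner (P x) (P x)" for x
    using assms by (metis orthogonal_projection_def orthogonal_projection_idem self_adjoint_def)
  then have "0 \<le> Re (cinner (P x) x)" for x
    by (metis inner_eq_Re_cinner inner_ge_zero)
  with assms show ?thesis
    by (simp add: positive_operator_def orthogonal_projection_def)
qed

lemma orthogonal_projection_complement:
  assumes "orthogonal_projection P"
  shows "orthogonal_projection (id_blinfun - P)"
  unfolding orthogonal_projection_def
proof
  show "self_adjoint (id_blinfun - P)"
    using assms by (simp add: orthogonal_projection_def self_adjoint_diff self_adjoint_id)
  show "(id_blinfun - P) o\<^sub>L (id_blinfun - P) = id_blinfun - P"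
    using orthogonal_projection_idem[OF assms]
    by (intro blinfun_eqI) (simp add: blinfun.diff_left blinfun.diff_right)
qed

text \<open>
  The operator is \<open>a\<close> on the range of \<open>P\<close> and \<open>b\<close> on its orthogonal complement, so the bound is
  the theorem of Pythagoras. This is the contractivity of the functional calculus below.
\<close>
lemma norm_projection_combination_le:
  assumes P: "orthogonal_projection P" and "\<bar>a\<bar> \<le> M" "\<bar>b\<bar> \<le> M"
  shows "norm (b *\<^sub>R id_blinfun + (a - b) *\<^sub>R P) \<le> M"
proof (rule norm_blinfun_bound)
  show "0 \<le> M" using assms(2) by linarith
  fix x
  define u where "u = P x"
  define w where "w = x - P x"
  have orth: "u \<bullet> w = 0"
  proof -
    have "cinner (P x) (x - P x) = cinner x (P x - P (P x))"
      using P by (simp add: orthogonal_projection_def self_adjoint_def blinfun.diff_right[symmetric])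
    also have "\<dots> = 0"
      using cinner_scaleR_right[of x 0 x] by (simp add: orthogonal_projection_idem[OF P])
    finally show ?thesis by (simp add: u_def w_def inner_eq_Re_cinner)
  qed
  have pyth: "(norm (c *\<^sub>R u + d *\<^sub>R w))\<^sup>2 = c\<^sup>2 * (norm u)\<^sup>2 + d\<^sup>2 * (norm w)\<^sup>2" for c d
    unfolding power2_norm_eq_inner using orth
    by (simp add: inner_add_left inner_add_right inner_commute[of w u] power2_eq_square)
  have ab: "a\<^sup>2 \<le> M\<^sup>2" "b\<^sup>2 \<le> M\<^sup>2"
    using assms by (auto intro: abs_le_square_iff[THEN iffD1])
  have "(norm (a *\<^sub>R u + b *\<^sub>R w))\<^sup>2 \<le> M\<^sup>2 * (norm u)\<^sup>2 + M\<^sup>2 * (norm w)\<^sup>2"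
    unfolding pyth by (intro add_mono mult_right_mono ab) auto
  also have "\<dots> = (M * norm x)\<^sup>2"
    using pyth[of 1 1] by (simp add: u_def w_def power_mult_distrib algebra_simps)
  finally have "norm (a *\<^sub>R u + b *\<^sub>R w) \<le> M * norm x"
    by (rule power2_le_imp_le) (use \<open>0 \<le> M\<close> in simp)
  moreover have "blinfun_apply (b *\<^sub>R id_blinfun + (a - b) *\<^sub>R P) x = a *\<^sub>R u + b *\<^sub>R w"
    by (simp add: u_def w_def blinfun.bilinear_simps scaleR_diff_left scaleR_diff_right)
  ultimately show "norm (blinfun_apply (b *\<^sub>R id_blinfun + (a - b) *\<^sub>R P) x) \<le> M * norm x"
    by simp
qed

section \<open>Functional calculus of a tuple with a two-point spectrum\<close>

text \<open>
  This is \<open>g p\<close> on the range of the projection \<open>P\<close> and \<open>g q\<close> on its complement, that is, the value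
  at \<open>g\<close> of the functional calculus of the tuple with joint eigenvalues \<open>p\<close> and \<open>q\<close>.
\<close>
definition two_point_operator ::
  "('h::complex_hilbert_space \<Rightarrow>\<^sub>L 'h) \<Rightarrow> real ^ 'n::finite \<Rightarrow> real ^ 'n \<Rightarrow> (real ^ 'n \<Rightarrow> real) \<Rightarrow> ('h \<Rightarrow>\<^sub>L 'h)"
  where "two_point_operator P p q g = g q *\<^sub>R id_blinfun + (g p - g q) *\<^sub>R P"

definition two_point_tuple ::
  "('h::complex_hilbert_space \<Rightarrow>\<^sub>L 'h) \<Rightarrow> real ^ 'n::finite \<Rightarrow> real ^ 'n \<Rightarrow> ('h \<Rightarrow>\<^sub>L 'h) ^ 'n"
  where "two_point_tuple P p q = (\<chi> i. two_point_operator P p q (\<lambda>x. x $ i))"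

lemma self_adjoint_two_point_operator:
  "orthogonal_projection P \<Longrightarrow> self_adjoint (two_point_operator P p q g)"
  by (simp add: two_point_operator_def orthogonal_projection_def self_adjoint_add
      self_adjoint_scaleR self_adjoint_id)

lemma two_point_operator_mult:
  assumes "orthogonal_projection P"
  shows "two_point_operator P p q (\<lambda>x. g x * h x) =
      two_point_operator P p q g o\<^sub>L two_point_operator P p q h"
  by (intro blinfun_eqI)
    (simp add: two_point_operator_def blinfun.bilinear_simps
      orthogonal_projection_idem[OF assms] algebra_simps)

lemma commuting_two_point_tuple:
  assumes "orthogonal_projection P"
  shows "commuting_self_adjoint (two_point_tuple P p q)"
  by (simp add: commuting_self_adjoint_def two_point_tuple_def mult.commute
      self_adjoint_two_point_operator[OF assms] two_point_operator_mult[OF assms, symmetric])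

lemma joint_eigenvalue_in_joint_spectrum:
  fixes S :: "('h::complex_hilbert_space \<Rightarrow>\<^sub>L 'h) ^ 'n::finite"
  assumes "x \<noteq> 0" and "\<And>i. (S $ i) x = l $ i *\<^sub>R x"
  shows "l \<in> joint_spectrum S"
proof -
  have False if "(\<Sum>i\<in>UNIV. B i o\<^sub>L (S $ i - (l $ i) *\<^sub>R id_blinfun)) = id_blinfun" for B
  proof -
    have "x = (\<Sum>i\<in>UNIV. B i o\<^sub>L (S $ i - (l $ i) *\<^sub>R id_blinfun)) x"
      using that by simp
    also have "\<dots> = 0"
      by (simp add: blinfun.sum_left blinfun.diff_left blinfun.scaleR_left assms)
    finally show False using \<open>x \<noteq> 0\<close> by simp
  qed
  then show ?thesis by (auto simp: joint_spectrum_def)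
qed

text \<open>
  Nontriviality of \<open>P\<close> makes both points joint eigenvalues. A bound for \<open>g\<close> on the joint spectrum then
  bounds \<open>g p\<close> and \<open>g q\<close>, and so the norm of the operator.
\<close>
lemma is_functional_calculus_two_point:
  fixes p q :: "real ^ 'n::finite"
  assumes P: "orthogonal_projection P" "P \<noteq> 0" "P \<noteq> id_blinfun"
  shows "is_functional_calculus (two_point_tuple P p q) (two_point_operator P p q)"
proof -
  obtain x where x: "P x \<noteq> 0"
    using P(2) by (metis blinfun_eqI zero_blinfun.rep_eq)
  have p: "p \<in> joint_spectrum (two_point_tuple P p q)"
    by (rule joint_eigenvalue_in_joint_spectrum[OF x])
      (simp add: two_point_tuple_def two_point_operator_def blinfun.bilinear_simps
        orthogonal_projection_idem[OF P(1)] algebra_simps)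
  obtain y where y: "y - P y \<noteq> 0"
    using P(3) by (metis blinfun_eqI blinfun_apply_id_blinfun id_apply right_minus_eq)
  have q: "q \<in> joint_spectrum (two_point_tuple P p q)"
    by (rule joint_eigenvalue_in_joint_spectrum[OF y])
      (simp add: two_point_tuple_def two_point_operator_def blinfun.bilinear_simps
        orthogonal_projection_idem[OF P(1)] algebra_simps)
  show ?thesis
    unfolding is_functional_calculus_def
  proof (intro conjI allI impI)
    fix g :: "real ^ 'n \<Rightarrow> real" and M :: real
    assume "\<forall>x\<in>joint_spectrum (two_point_tuple P p q). \<bar>g x\<bar> \<le> M"
    then show "norm (two_point_operator P p q g) \<le> M"
      unfolding two_point_operator_def
      using p q by (intro norm_projection_combination_le[OF P(1)]) auto
  next
    fix g h :: "real ^ 'n \<Rightarrow> real"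
    show "two_point_operator P p q (\<lambda>x. g x + h x) =
        two_point_operator P p q g + two_point_operator P p q h"
      by (simp add: two_point_operator_def algebra_simps)
  qed (simp_all add: self_adjoint_two_point_operator[OF P(1)] two_point_operator_mult[OF P(1)],
      simp_all add: two_point_operator_def two_point_tuple_def)
qed

section \<open>A rotating rank-one projection\<close>

definition rank_one :: "'h::complex_hilbert_space \<Rightarrow> 'h \<Rightarrow> ('h::complex_hilbert_space \<Rightarrow>\<^sub>L 'h)" where
  "rank_one a b = Blinfun (\<lambda>x. cinner x b *\<^sub>C a)"

lemma rank_one_apply: "rank_one a b x = cinner x b *\<^sub>C a"
proof -
  have "bounded_linear (\<lambda>x. cinner x b *\<^sub>C a)"
    unfolding cinner_scaleC_eq_inner by (intro bounded_linear_intros)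
  then show ?thesis by (simp add: rank_one_def bounded_linear_Blinfun_apply)
qed

lemma rank_one_add:
  "rank_one (a + b) c = rank_one a c + rank_one b c"
  "rank_one c (a + b) = rank_one c a + rank_one c b"
  by (auto intro!: blinfun_eqI
      simp: rank_one_apply blinfun.add_left scaleC_add_left scaleC_add_right cinner_simps)

lemma rank_one_scaleR:
  "rank_one (r *\<^sub>R a) b = r *\<^sub>R rank_one a b"
  "rank_one a (r *\<^sub>R b) = r *\<^sub>R rank_one a b"
  by (auto intro!: blinfun_eqI
      simp: rank_one_apply blinfun.scaleR_left scaleC_scaleR_commute cinner_simps
        scaleR_eq_scaleC scaleC_scaleC mult.commute)

lemma orthogonal_projection_rank_one:
  assumes "cinner u u = 1"
  shows "orthogonal_projection (rank_one u u)"
  unfolding orthogonal_projection_def self_adjoint_def complex_linear_def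
  using assms cinner_commute
  by (auto intro!: blinfun_eqI simp: rank_one_apply cinner_simps scaleC_scaleC
      cinner_commute[of u, symmetric] mult.commute)

definition rotating_projection :: "'h::complex_hilbert_space \<Rightarrow> 'h \<Rightarrow> real \<Rightarrow> ('h::complex_hilbert_space \<Rightarrow>\<^sub>L 'h)" where
  "rotating_projection e1 e2 t =
     rank_one (cos t *\<^sub>R e1 + sin t *\<^sub>R e2) (cos t *\<^sub>R e1 + sin t *\<^sub>R e2)"

lemma rotating_projection_expand:
  "rotating_projection e1 e2 t = (cos t)\<^sup>2 *\<^sub>R rank_one e1 e1
     + (cos t * sin t) *\<^sub>R (rank_one e1 e2 + rank_one e2 e1) + (sin t)\<^sup>2 *\<^sub>R rank_one e2 e2"
  by (simp add: rotating_projection_def rank_one_add rank_one_scaleR power2_eq_square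
      algebra_simps)

text \<open>
  The right-hand side is the derivative of the expansion above. Being a difference of projections, it lies
  between \<open>- I\<close> and \<open>I\<close>, which is what the positivity of the curve of tuples rests on.
\<close>
lemma rotating_projection_quarter_difference:
  "rotating_projection e1 e2 (t + pi/4) - rotating_projection e1 e2 (t - pi/4) =
     (- 2 * cos t * sin t) *\<^sub>R rank_one e1 e1
     + ((cos t)\<^sup>2 - (sin t)\<^sup>2) *\<^sub>R (rank_one e1 e2 + rank_one e2 e1)
     + (2 * cos t * sin t) *\<^sub>R rank_one e2 e2"
proof -
  define s where "s = sqrt 2 / 2"
  define a where "a = cos t"
  define b where "b = sin t"
  have s: "s * s = 1/2" by (simp add: s_def)
  have c1: "cos (t + pi/4) = s * (a - b)" and s1: "sin (t + pi/4) = s * (b + a)"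
    and c2: "cos (t - pi/4) = s * (a + b)" and s2: "sin (t - pi/4) = s * (b - a)"
    by (simp_all add: cos_add sin_add cos_diff sin_diff cos_45 sin_45 s_def a_def b_def algebra_simps)
  have prod: "(s * x) * (s * y) = x * y / 2" for x y
    using s by (metis mult.commute mult.left_commute mult.right_neutral times_divide_eq_right)
  have "rotating_projection e1 e2 (t + pi/4) - rotating_projection e1 e2 (t - pi/4) =
     ((cos (t + pi/4))\<^sup>2 - (cos (t - pi/4))\<^sup>2) *\<^sub>R rank_one e1 e1
     + (cos (t + pi/4) * sin (t + pi/4) - cos (t - pi/4) * sin (t - pi/4)) *\<^sub>R
         (rank_one e1 e2 + rank_one e2 e1)
     + ((sin (t + pi/4))\<^sup>2 - (sin (t - pi/4))\<^sup>2) *\<^sub>R rank_one e2 e2"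
    unfolding rotating_projection_expand by (simp add: scaleR_diff_left)
  moreover have "(cos (t + pi/4))\<^sup>2 - (cos (t - pi/4))\<^sup>2 = - 2 * a * b"
    and "(sin (t + pi/4))\<^sup>2 - (sin (t - pi/4))\<^sup>2 = 2 * a * b"
    and "cos (t + pi/4) * sin (t + pi/4) - cos (t - pi/4) * sin (t - pi/4) = a\<^sup>2 - b\<^sup>2"
    unfolding c1 s1 c2 s2 power2_eq_square prod by (simp_all add: field_simps)
  ultimately show ?thesis by (simp add: a_def b_def)
qed

lemma rotating_projection_has_vector_derivative:
  "(rotating_projection e1 e2 has_vector_derivative
      rotating_projection e1 e2 (t + pi/4) - rotating_projection e1 e2 (t - pi/4)) (at t)"
  unfolding rotating_projection_quarter_difference
  by (subst rotating_projection_expand[abs_def])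
    (auto intro!: derivative_eq_intros
      simp: has_real_derivative_iff_has_vector_derivative[symmetric] power2_eq_square
       algebra_simps)

section \<open>Functions of one variable\<close>

text \<open>
  Where \<open>g > g y\<close>, the Loewner inequality says that \<open>x \<mapsto> 1 / (g' y * (x - y)) - 1 / (g x - g y)\<close>
  is nondecreasing. Its limit superior at infinity is at most \<open>0\<close>, so it is nonpositive
  throughout, and at \<open>x0\<close> this is the claim.
\<close>
lemma difference_le_tangent_right:
  fixes g g' :: "real \<Rightarrow> real"
  assumes deriv: "\<And>x. (g has_real_derivative g' x) (at x)"
    and nonneg: "\<And>x. 0 \<le> g' x"
    and loewner: "\<And>x y. (g y - g x)\<^sup>2 \<le> (y - x)\<^sup>2 * (g' x * g' y)"
    and "y < x0"
  shows "g x0 - g y \<le> g' y * (x0 - y)"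
proof -
  have mono: "g a \<le> g b" if "a \<le> b" for a b
    by (rule DERIV_nonneg_imp_nondecreasing[OF that]) (use deriv nonneg in blast)
  show ?thesis
  proof (cases "g x0 = g y")
    case True
    then show ?thesis using nonneg[of y] \<open>y < x0\<close> by simp
  next
    case False
    then have pos: "g y < g x" if "x0 \<le> x" for x
      using mono[of y x0] mono[OF that] \<open>y < x0\<close> by linarith
    have g'y: "0 < g' y"
    proof (rule ccontr)
      assume "\<not> 0 < g' y"
      then have "g' y = 0" using nonneg[of y] by simp
      then have "(g y - g x0)\<^sup>2 \<le> 0" using loewner[of y x0] by simp
      then show False using False by simp
    qed
    define h where "h x = 1 / (g' y * (x - y)) - 1 / (g x - g y)" for x
    have hmono: "h x0 \<le> h x" if "x0 \<le> x" for x
    proof (rule DERIV_nonneg_imp_nondecreasing[OF that])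
      fix u assume u: "x0 \<le> u" "u \<le> x"
      have uy: "0 < u - y" "0 < g u - g y" using u pos[of u] \<open>y < x0\<close> by auto
      have "(h has_real_derivative g' u / (g u - g y)\<^sup>2 - 1 / (g' y * (u - y)\<^sup>2)) (at u)"
        unfolding h_def[abs_def] using uy g'y
        by (auto intro!: derivative_eq_intros deriv simp: power2_eq_square)
      moreover have "1 / (g' y * (u - y)\<^sup>2) \<le> g' u / (g u - g y)\<^sup>2"
        using loewner[of u y] uy g'y
        by (simp add: field_simps power2_commute)
      ultimately show "\<exists>d. (h has_real_derivative d) (at u) \<and> 0 \<le> d" by force
    qed
    have "h x0 \<le> 0"
    proof (rule tendsto_lowerbound)
      show "((\<lambda>x. 1 / (g' y * (x - y))) \<longlongrightarrow> 0) at_top"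
        using g'y by real_asymp
      show "\<forall>\<^sub>F x in at_top. h x0 \<le> 1 / (g' y * (x - y))"
        using eventually_ge_at_top[of x0]
      proof eventually_elim
        case (elim x)
        then show ?case using hmono[of x] pos[of x] by (simp add: h_def) (smt (verit) zero_less_divide_1_iff)
      qed
    qed simp
    then show ?thesis
      using g'y pos[of x0] \<open>y < x0\<close> by (simp add: h_def field_simps)
  qed
qed

text \<open>
  On a large interval around \<open>0\<close>, \<open>1\<close> and \<open>x\<close>, let \<open>m\<close> be a minimum of \<open>g'\<close>. Then
  \<open>u \<mapsto> g u - g' m * u\<close> is nondecreasing by minimality, while the tangent estimates at \<open>m\<close> on either
  side bound its increase by \<open>0\<close>.
\<close>
lemma affine_if_loewner_2:
  fixes g g' :: "real \<Rightarrow> real"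
  assumes deriv: "\<And>x. (g has_real_derivative g' x) (at x)"
    and cont: "continuous_on UNIV g'"
    and nonneg: "\<And>x. 0 \<le> g' x"
    and loewner: "\<And>x y. (g y - g x)\<^sup>2 \<le> (y - x)\<^sup>2 * (g' x * g' y)"
  shows "g x = g 0 + x * (g 1 - g 0)"
proof -
  have right: "g z - g y \<le> g' y * (z - y)" if "y \<le> z" for y z
    using difference_le_tangent_right[OF deriv nonneg loewner, of y z] that
    by (cases "y = z") auto
  have left: "g y - g z \<le> g' y * (y - z)" if "z \<le> y" for y z
  proof -
    \<comment> \<open>The hypotheses are invariant under \<open>g \<mapsto> (\<lambda>x. - g (- x))\<close>, which exchanges the two sides.\<close>
    have "- g z - - g y \<le> g' y * (- z - - y)" if "z < y"
      using difference_le_tangent_right[of "\<lambda>x. - g (- x)" "\<lambda>x. g' (- x)" "- y" "- z"] that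
        nonneg loewner[of "- x" "- y" for x y] 
      by (force intro!: derivative_eq_intros DERIV_chain2[OF deriv] simp: power2_commute algebra_simps)
    then show ?thesis using that by (cases "z = y") (auto simp: algebra_simps)
  qed
  define N where "N = \<bar>x\<bar> + 1"
  obtain m where m: "m \<in> {-N..N}" and min: "\<And>u. u \<in> {-N..N} \<Longrightarrow> g' m \<le> g' u"
    using continuous_attains_inf[of "{-N..N}" g'] continuous_on_subset[OF cont]
    unfolding N_def by force
  define k where "k u = g u - g' m * u" for u
  have kmono: "k u \<le> k v" if "-N \<le> u" "u \<le> v" "v \<le> N" for u v
    by (rule DERIV_nonneg_imp_nondecreasing[OF that(2)])
      (use that min in \<open>force intro!: derivative_eq_intros deriv simp: k_def[abs_def]\<close>)
  have const: "k u = k m" if "u \<in> {-N..N}" for u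
    using that m kmono[of u m] kmono[of m u] left[of u m] right[of m u]
    by (cases "u \<le> m") (auto simp: k_def algebra_simps)
  have "k x = k m" "k 0 = k m" "k 1 = k m"
    by (auto intro!: const simp: N_def)
  then have "g x = g 0 + g' m * x" "g 1 = g 0 + g' m"
    by (auto simp: k_def algebra_simps)
  then show ?thesis by (simp add: algebra_simps)
qed

section \<open>The Loewner inequality along nonnegative directions\<close>

lemma bounded_linear_scaled_tuple:
  "bounded_linear (\<lambda>x :: 'a::real_normed_vector. \<chi> i. v $ i *\<^sub>R x :: 'a ^ 'n::finite)"
proof (rule bounded_linear_intro[where K = "\<Sum>i\<in>UNIV. \<bar>v $ i\<bar>"])
  fix x y :: 'a and r :: real
  show "(\<chi> i. v $ i *\<^sub>R (x + y) :: 'a ^ 'n) = (\<chi> i. v $ i *\<^sub>R x) + (\<chi> i. v $ i *\<^sub>R y)"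
    by (simp add: vec_eq_iff scaleR_add_right)
  show "(\<chi> i. v $ i *\<^sub>R (r *\<^sub>R x) :: 'a ^ 'n) = r *\<^sub>R (\<chi> i. v $ i *\<^sub>R x)"
    by (simp add: vec_eq_iff)
  show "norm (\<chi> i. v $ i *\<^sub>R x :: 'a ^ 'n) \<le> norm x * (\<Sum>i\<in>UNIV. \<bar>v $ i\<bar>)"
    unfolding norm_vec_def
    by (rule order_trans[OF L2_set_le_sum]) (simp_all add: sum_distrib_left mult.commute)
qed

lemma has_real_derivative_along_line:
  fixes f :: "'a::real_inner \<Rightarrow> real"
  assumes grad: "\<And>x. (f has_derivative (\<lambda>h. G x \<bullet> h)) (at x)"
  shows "((\<lambda>t. f (w + t *\<^sub>R v)) has_real_derivative G (w + t *\<^sub>R v) \<bullet> v) (at t)"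
proof -
  have "((\<lambda>t. w + t *\<^sub>R v) has_derivative (\<lambda>s. s *\<^sub>R v)) (at t)"
    by (auto intro!: derivative_eq_intros)
  from has_derivative_compose[OF this grad]
  have "((\<lambda>t. f (w + t *\<^sub>R v)) has_derivative (\<lambda>s. G (w + t *\<^sub>R v) \<bullet> (s *\<^sub>R v))) (at t)" .
  moreover have "(\<lambda>s. G (w + t *\<^sub>R v) \<bullet> (s *\<^sub>R v)) = (*) (G (w + t *\<^sub>R v) \<bullet> v)"
    by (simp add: fun_eq_iff)
  ultimately show ?thesis by (simp add: has_field_derivative_def)
qed

text \<open>
  In the basis \<open>e1\<close>, \<open>e2\<close> the derivative of \<open>f (S t)\<close> at \<open>0\<close> has the directional derivatives of \<open>f\<close>
  at the two eigenvalues on its diagonal and the increment of \<open>f\<close> off it. The form is its value on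
  \<open>\<alpha> e1 + \<beta> e2\<close>.
\<close>
lemma loewner_form_nonneg:
  fixes f :: "real ^ 'n::finite \<Rightarrow> real" and e1 e2 :: "'h::complex_hilbert_space"
  assumes mono: "locally_operator_monotone_on TYPE('h) UNIV f"
    and grad: "\<And>x. (f has_derivative (\<lambda>h. G x \<bullet> h)) (at x)"
    and e: "cinner e1 e1 = 1" "cinner e2 e2 = 1" "cinner e1 e2 = 0" "cinner e2 e1 = 0"
    and v: "\<And>i. 0 \<le> v $ i"
  shows "0 \<le> (G (w + v) \<bullet> v) * \<alpha>\<^sup>2 + (G w \<bullet> v) * \<beta>\<^sup>2 + 2 * (f (w + v) - f w) * (\<alpha> * \<beta>)"
proof -
  define P where "P = rotating_projection e1 e2"
  define P' where "P' t = P (t + pi/4) - P (t - pi/4)" for t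
  have P': "(P has_vector_derivative P' t) (at t)" for t
    unfolding P_def P'_def by (rule rotating_projection_has_vector_derivative)
  have unit: "cinner (cos t *\<^sub>R e1 + sin t *\<^sub>R e2) (cos t *\<^sub>R e1 + sin t *\<^sub>R e2) = 1"
    "cinner (- sin t *\<^sub>R e1 + cos t *\<^sub>R e2) (- sin t *\<^sub>R e1 + cos t *\<^sub>R e2) = 1"
    "cinner (- sin t *\<^sub>R e1 + cos t *\<^sub>R e2) (cos t *\<^sub>R e1 + sin t *\<^sub>R e2) = 0" for t
    by (simp_all add: cinner_simps e del: scaleR_minus_left)
      (simp_all add: of_real_mult[symmetric] of_real_add[symmetric] power2_eq_square[symmetric]
        of_real_power[symmetric] del: of_real_mult of_real_add of_real_power)
  have proj: "orthogonal_projection (P t)" for t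
    unfolding P_def rotating_projection_def by (rule orthogonal_projection_rank_one[OF unit(1)])
  have nz: "y \<noteq> 0" if "cinner y y = 1" for y :: 'h
    using that by (auto simp: cinner_self)
  have P_nontriv: "P t \<noteq> 0" "P t \<noteq> id_blinfun" for t
  proof -
    let ?u = "cos t *\<^sub>R e1 + sin t *\<^sub>R e2" and ?u' = "- sin t *\<^sub>R e1 + cos t *\<^sub>R e2"
    have "P t ?u = 1 *\<^sub>C ?u"
      by (simp add: P_def rotating_projection_def rank_one_apply unit del: scaleR_minus_left)
    then show "P t \<noteq> 0"
      using nz[OF unit(1)[of t]] scaleR_eq_scaleC[of 1 ?u] by auto
    have "P t ?u' = 0 *\<^sub>C ?u"
      by (simp only: P_def rotating_projection_def rank_one_apply unit)
    then show "P t \<noteq> id_blinfun"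
      using nz[OF unit(2)[of t]] scaleR_eq_scaleC[of 0 ?u] by auto
  qed
  define p where "p t = w + v + t *\<^sub>R v" for t
  define q where "q t = w + t *\<^sub>R v" for t
  define S where "S t = two_point_tuple (P t) (p t) (q t)" for t
  define F where "F t = two_point_operator (P t) (p t) (q t) f" for t
  define S' where "S' t = (\<chi> i. v $ i *\<^sub>R (id_blinfun + P' t))" for t
  have S_eq: "S = (\<lambda>t. (\<chi> i. w $ i *\<^sub>R id_blinfun) + (\<chi> i. v $ i *\<^sub>R (t *\<^sub>R id_blinfun + P t)))"
    by (auto simp: S_def two_point_tuple_def two_point_operator_def p_def q_def vec_eq_iff
        algebra_simps)
  have inner_deriv: "((\<lambda>t. t *\<^sub>R id_blinfun + P t) has_vector_derivative id_blinfun + P' t) (at t)" for t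
    by (auto intro!: derivative_eq_intros P')
  have S': "(S has_vector_derivative S' t) (at t)" for t
    unfolding S_eq S'_def
    using has_vector_derivative_add[OF has_vector_derivative_const
        bounded_linear.has_vector_derivative[OF bounded_linear_scaled_tuple[of v] inner_deriv]]
    by simp
  have contP: "continuous_on UNIV P"
    by (meson P' continuous_at_imp_continuous_on has_vector_derivative_continuous)
  have contP': "continuous_on UNIV P'"
    unfolding P'_def[abs_def]
    by (intro continuous_on_diff continuous_on_compose2[OF contP] continuous_intros) auto
  have contS': "continuous_on UNIV S'"
    unfolding S'_def[abs_def]
    by (rule bounded_linear.continuous_on[OF bounded_linear_scaled_tuple])
      (intro continuous_on_add continuous_on_const contP')
  have "S C1_differentiable_on {-1<..<1}"
    unfolding C1_differentiable_on_def
    using S' contS' continuous_on_subset by blast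
  moreover have "commuting_self_adjoint (S t)" for t
    unfolding S_def by (rule commuting_two_point_tuple[OF proj])
  moreover have "is_function_of f (S t) (F t)" for t
    unfolding is_function_of_def S_def F_def
    using is_functional_calculus_two_point[OF proj P_nontriv] by blast
  moreover have "positive_operator (vector_derivative S (at 0) $ i)" for i
  proof -
    \<comment> \<open>A sum of a projection and the complement of another one.\<close>
    have "id_blinfun + P' 0 = P (0 + pi/4) + (id_blinfun - P (0 - pi/4))"
      by (simp add: P'_def)
    then have "positive_operator (id_blinfun + P' 0)"
      using proj by (metis positive_operator_add positive_operator_projection
          orthogonal_projection_complement)
    then show ?thesis
      using vector_derivative_at[OF S', of 0] v[of i]
      by (simp add: S'_def positive_operator_scaleR)
  qed
  ultimately obtain D where D: "(F has_vector_derivative D) (at 0)" "positive_operator D"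
    using mono[unfolded locally_operator_monotone_on_def, THEN conjunct2, rule_format,
        of S "-1" 1 F 0] by auto
  have line: "((\<lambda>t. f (y + t *\<^sub>R v)) has_real_derivative G y \<bullet> v) (at 0)" for y
    using has_real_derivative_along_line[OF grad, of y v 0] by simp
  have F': "(F has_vector_derivative (G w \<bullet> v) *\<^sub>R id_blinfun
      + ((f (w + v) - f w) *\<^sub>R P' 0 + (G (w + v) \<bullet> v - G w \<bullet> v) *\<^sub>R P 0)) (at 0)"
    unfolding F_def[abs_def] two_point_operator_def p_def q_def
    by (auto intro!: derivative_eq_intros line P')
  have form: "Re (cinner (P t y) y) = (cmod (cinner y (cos t *\<^sub>R e1 + sin t *\<^sub>R e2)))\<^sup>2" for t y
    by (simp add: P_def rotating_projection_def rank_one_apply cinner_scaleC_left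
        cinner_commute[of "cos t *\<^sub>R e1 + sin t *\<^sub>R e2" y] complex_norm_square[symmetric])
  define y where "y = \<alpha> *\<^sub>R e1 + \<beta> *\<^sub>R e2"
  have form_y: "Re (cinner (P t y) y) = (\<alpha> * cos t + \<beta> * sin t)\<^sup>2" for t
  proof -
    have "cinner y (cos t *\<^sub>R e1 + sin t *\<^sub>R e2) = of_real (\<alpha> * cos t + \<beta> * sin t)"
      by (simp add: y_def cinner_simps e)
    then show ?thesis unfolding form by (simp only: norm_of_real power2_abs)
  qed
  have P0: "Re (cinner (P 0 y) y) = \<alpha>\<^sup>2" using form_y[of 0] by simp
  have P'0: "Re (cinner (P' 0 y) y) = 2 * (\<alpha> * \<beta>)"
  proof -
    have "Re (cinner (P' 0 y) y) = Re (cinner (P (pi/4) y) y) - Re (cinner (P (- (pi/4)) y) y)"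
      by (simp add: P'_def blinfun.diff_left inner_eq_Re_cinner[symmetric] inner_diff_left)
    also have "\<dots> = 2 * (\<alpha> * \<beta>)"
      unfolding form_y by (simp add: cos_45 sin_45 power2_eq_square algebra_simps)
    finally show ?thesis .
  qed
  have yy: "Re (cinner y y) = \<alpha>\<^sup>2 + \<beta>\<^sup>2"
    by (simp add: y_def cinner_simps e power2_eq_square)
  have "0 \<le> Re (cinner (D y) y)" using D(2) by (simp add: positive_operator_def)
  also have "\<dots> = (G w \<bullet> v) * (\<alpha>\<^sup>2 + \<beta>\<^sup>2)
      + ((f (w + v) - f w) * (2 * (\<alpha> * \<beta>)) + (G (w + v) \<bullet> v - G w \<bullet> v) * \<alpha>\<^sup>2)"
    unfolding vector_derivative_unique_at[OF D(1) F']
    by (simp add: blinfun.add_left blinfun.scaleR_left cinner_simps P0 P'0 yy)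
  finally show ?thesis by (simp add: algebra_simps)
qed

lemma square_le_if_form_nonneg:
  fixes a b c :: real
  assumes "\<And>\<alpha> \<beta>. 0 \<le> a * \<alpha>\<^sup>2 + b * \<beta>\<^sup>2 + 2 * c * (\<alpha> * \<beta>)"
  shows "0 \<le> b" "c\<^sup>2 \<le> a * b"
proof -
  show b: "0 \<le> b" using assms[of 0 1] by simp
  show "c\<^sup>2 \<le> a * b"
  proof (cases "b = 0")
    case True
    have "c = 0"
    proof (rule ccontr)
      assume "c \<noteq> 0"
      \<comment> \<open>At this point the form takes the value \<open>- 1\<close>.\<close>
      then show False
        using assms[of 1 "- (a + 1) / (2 * c)"] True by (simp add: field_simps)
    qed
    then show ?thesis using True by simp
  next
    case False
    then have "0 \<le> b * (a * b - c\<^sup>2)"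
      using assms[of b "- c"] by (simp add: power2_eq_square algebra_simps)
    then show ?thesis using b False by (simp add: zero_le_mult_iff)
  qed
qed

text \<open>
  Applied to the direction \<open>(y - x) *\<^sub>R v\<close>, which is nonnegative for \<open>x \<le> y\<close>, the Loewner form
  compares the two points of the line with parameters \<open>x\<close> and \<open>y\<close>.
\<close>
lemma affine_along_nonneg_direction:
  fixes f :: "real ^ 'n::finite \<Rightarrow> real"
  assumes infinite_dimensional: "\<not> (\<exists>B :: 'h::complex_hilbert_space set. finite B \<and> span B = UNIV)"
    and mono: "locally_operator_monotone_on TYPE('h) UNIV f"
    and cont: "continuous_on UNIV G"
    and grad: "\<And>x. (f has_derivative (\<lambda>h. G x \<bullet> h)) (at x)"
    and v: "\<And>i. 0 \<le> v $ i"
  shows "0 \<le> G w \<bullet> v" and "f (w + s *\<^sub>R v) = f w + s * (G w \<bullet> v)"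
proof -
  obtain e1 e2 :: 'h where e: "cinner e1 e1 = 1" "cinner e2 e2 = 1" "cinner e1 e2 = 0" "cinner e2 e1 = 0"
    using exists_orthonormal_pair[OF infinite_dimensional] by blast
  have form: "0 \<le> (G (y + z) \<bullet> z) * \<alpha>\<^sup>2 + (G y \<bullet> z) * \<beta>\<^sup>2 + 2 * (f (y + z) - f y) * (\<alpha> * \<beta>)"
    if "\<And>i. 0 \<le> z $ i" for y z \<alpha> \<beta>
    by (rule loewner_form_nonneg[OF mono grad e that])
  have nonneg: "0 \<le> G y \<bullet> v" for y
    by (rule square_le_if_form_nonneg(1)[OF form[OF v]])
  then show "0 \<le> G w \<bullet> v" .
  define g where "g t = f (w + t *\<^sub>R v)" for t
  define g' where "g' t = G (w + t *\<^sub>R v) \<bullet> v" for t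
  have deriv: "(g has_real_derivative g' t) (at t)" for t
    unfolding g_def g'_def by (rule has_real_derivative_along_line[OF grad])
  have cont': "continuous_on UNIV g'"
    unfolding g'_def by (intro continuous_intros continuous_on_compose2[OF cont]) auto
  have loewner_le: "(g y - g x)\<^sup>2 \<le> (y - x)\<^sup>2 * (g' x * g' y)" if "x \<le> y" for x y
  proof -
    have y: "w + x *\<^sub>R v + (y - x) *\<^sub>R v = w + y *\<^sub>R v" by (simp add: algebra_simps)
    have "0 \<le> ((y - x) *\<^sub>R v) $ i" for i using that v by simp
    then have "0 \<le> ((y - x) * g' y) * \<alpha>\<^sup>2 + ((y - x) * g' x) * \<beta>\<^sup>2 + 2 * (g y - g x) * (\<alpha> * \<beta>)" for \<alpha> \<beta>
      using form[of "(y - x) *\<^sub>R v" "w + x *\<^sub>R v" \<alpha> \<beta>] unfolding y by (simp add: g_def g'_def)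
    from square_le_if_form_nonneg(2)[OF this] show ?thesis
      by (simp add: power2_eq_square mult_ac)
  qed
  have loewner: "(g y - g x)\<^sup>2 \<le> (y - x)\<^sup>2 * (g' x * g' y)" for x y
    using loewner_le[of x y] loewner_le[of y x]
    by (cases "x \<le> y") (simp_all add: power2_commute mult.commute)
  have "g t = g 0 + t * (g 1 - g 0)" for t
    by (rule affine_if_loewner_2[OF deriv cont' _ loewner]) (simp add: g'_def nonneg)
  then have g_eq: "g = (\<lambda>t. g 0 + t * (g 1 - g 0))" by blast
  have "(g has_real_derivative g 1 - g 0) (at 0)"
    by (subst g_eq) (auto intro!: derivative_eq_intros)
  then have "g 1 - g 0 = g' 0" using deriv DERIV_unique by blast
  then show "f (w + s *\<^sub>R v) = f w + s * (G w \<bullet> v)"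
    using fun_cong[OF g_eq, of s] by (simp add: g_def g'_def)
qed

text \<open>
  The function is known on the orthant from lines through \<open>0\<close>. The line through \<open>w\<close> in the
  direction \<open>u = (1, ..., 1)\<close> has its points with parameters \<open>N\<close> and \<open>N + 1\<close> in the orthant, and
  the values at two points determine an affine function on the line, hence its value at \<open>w\<close>.
\<close>
lemma affine_if_affine_along_nonneg_directions:
  fixes f :: "real ^ 'n::finite \<Rightarrow> real"
  assumes line: "\<And>w v s. (\<And>i. 0 \<le> v $ i) \<Longrightarrow> f (w + s *\<^sub>R v) = f w + s * (G w \<bullet> v)"
  shows "f w = G 0 \<bullet> w + f 0"
proof -
  define u :: "real ^ 'n" where "u = (\<chi> i. 1)"
  have u: "0 \<le> u $ i" for i by (simp add: u_def)
  define N where "N = norm w"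
  have orthant: "f z = f 0 + G 0 \<bullet> z" if "\<And>i. 0 \<le> z $ i" for z
    using line[OF that, of 0 1] by simp
  have enters: "f (w + (N + k) *\<^sub>R u) = f 0 + G 0 \<bullet> (w + (N + k) *\<^sub>R u)" if "0 \<le> k" for k
    by (rule orthant)
      (use that component_le_norm_cart[of w] in \<open>simp add: u_def N_def; smt (verit)\<close>)
  have at_N: "f w + N * (G w \<bullet> u) = f 0 + G 0 \<bullet> w + N * (G 0 \<bullet> u)"
    and at_N1: "f w + (N + 1) * (G w \<bullet> u) = f 0 + G 0 \<bullet> w + (N + 1) * (G 0 \<bullet> u)"
    using enters[of 0] enters[of 1] line[OF u, of w N] line[OF u, of w "N + 1"]
    by (simp_all add: inner_add_right)
  have "G w \<bullet> u = G 0 \<bullet> u"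
    using at_N at_N1 unfolding distrib_right by linarith
  with at_N show ?thesis by simp
qed

section \<open>Affine functions with nonnegative slopes\<close>

lemma functional_calculus_affine:
  fixes S :: "('h::complex_hilbert_space \<Rightarrow>\<^sub>L 'h) ^ 'n::finite"
  assumes "is_functional_calculus S \<Phi>"
  shows "\<Phi> (\<lambda>w. x \<bullet> w + c) = (\<Sum>i\<in>UNIV. x $ i *\<^sub>R S $ i) + c *\<^sub>R id_blinfun"
proof -
  note fc = assms[unfolded is_functional_calculus_def]
  have add: "\<Phi> (\<lambda>w. g w + h w) = \<Phi> g + \<Phi> h"
    and mult: "\<Phi> (\<lambda>w. g w * h w) = \<Phi> g o\<^sub>L \<Phi> h"
    if "continuous_on UNIV g" "continuous_on UNIV h" for g h
    using fc that continuous_on_subset by blast+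
  have const: "\<Phi> (\<lambda>_. r) = r *\<^sub>R id_blinfun" and coord: "\<Phi> (\<lambda>w. w $ i) = S $ i" for r i
    using fc by blast+
  have monomial: "\<Phi> (\<lambda>w. x $ i * w $ i) = x $ i *\<^sub>R S $ i" for i
    by (subst mult) (auto intro!: continuous_intros blinfun_eqI
        simp: const coord blinfun.scaleR_left)
  have "\<Phi> (\<lambda>w. \<Sum>i\<in>I. x $ i * w $ i) = (\<Sum>i\<in>I. x $ i *\<^sub>R S $ i)" if "finite I" for I
    using that
  proof induction
    case empty
    then show ?case using const[of 0] by simp
  next
    case (insert i I)
    then show ?case
      by (simp add: monomial) (subst add, auto intro!: continuous_intros simp: monomial)
  qed
  then have "\<Phi> (\<lambda>w. x \<bullet> w) = (\<Sum>i\<in>UNIV. x $ i *\<^sub>R S $ i)"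
    by (simp add: inner_vec_def)
  then show ?thesis
    by (subst add) (auto intro!: continuous_intros simp: const)
qed

lemma affine_locally_operator_monotone:
  fixes x :: "real ^ 'n::finite"
  assumes x: "\<And>i. 0 \<le> x $ i"
  shows "locally_operator_monotone_on TYPE('h::complex_hilbert_space) UNIV (\<lambda>w. x \<bullet> w + c)"
  unfolding locally_operator_monotone_on_def
proof (intro conjI allI impI ballI)
  show "C1_function_on UNIV (\<lambda>w. x \<bullet> w + c)"
    unfolding C1_function_on_def
    by (intro exI[of _ "\<lambda>_. x"]) (auto intro!: derivative_eq_intros)
next
  fix a b :: real and S :: "real \<Rightarrow> ('h \<Rightarrow>\<^sub>L 'h) ^ 'n" and F t
  assume C1: "S C1_differentiable_on {a<..<b}"
    and fc: "\<forall>t\<in>{a<..<b}. is_function_of (\<lambda>w. x \<bullet> w + c) (S t) (F t)"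
    and t: "t \<in> {a<..<b}"
    and pos: "\<forall>i. positive_operator (vector_derivative S (at t) $ i)"
  define S' where "S' = vector_derivative S (at t)"
  have S': "(S has_vector_derivative S') (at t)"
    using C1 t unfolding S'_def C1_differentiable_on_eq
    by (simp add: vector_derivative_works[symmetric])
  have comp: "((\<lambda>t. S t $ i) has_vector_derivative S' $ i) (at t)" for i
    by (rule bounded_linear.has_vector_derivative[OF bounded_linear_vec_nth S'])
  have F: "F s = (\<Sum>i\<in>UNIV. x $ i *\<^sub>R S s $ i) + c *\<^sub>R id_blinfun" if "s \<in> {a<..<b}" for s
    using fc that unfolding is_function_of_def by (metis functional_calculus_affine)
  have "((\<lambda>s. (\<Sum>i\<in>UNIV. x $ i *\<^sub>R S s $ i) + c *\<^sub>R id_blinfun) has_vector_derivative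
      (\<Sum>i\<in>UNIV. x $ i *\<^sub>R S' $ i)) (at t)"
    by (auto intro!: derivative_eq_intros comp)
  then have "(F has_vector_derivative (\<Sum>i\<in>UNIV. x $ i *\<^sub>R S' $ i)) (at t)"
    by (rule has_vector_derivative_transform_within_open[OF _ open_greaterThanLessThan t])
      (simp add: F)
  moreover have "positive_operator (\<Sum>i\<in>UNIV. x $ i *\<^sub>R S' $ i)"
    using pos x by (intro positive_operator_sum positive_operator_scaleR) (auto simp: S'_def)
  ultimately show "\<exists>D. (F has_vector_derivative D) (at t) \<and> positive_operator D" by blast
qed

theorem proposition1p5:
  assumes infinite_dimensional: "\<not> (\<exists>B :: 'h::complex_hilbert_space set. finite B \<and> span B = UNIV)"
  shows "L_class TYPE('h) (UNIV :: (real ^ 'n::finite) set) =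
           {f. \<exists>(x :: real ^ 'n) (c :: real). (\<forall>i. 0 \<le> x $ i) \<and> f = (\<lambda>w. x \<bullet> w + c)}"
proof (intro equalityI subsetI)
  fix f :: "real ^ 'n \<Rightarrow> real"
  assume "f \<in> L_class TYPE('h) UNIV"
  then have mono: "locally_operator_monotone_on TYPE('h) UNIV f"
    by (simp add: L_class_def)
  then obtain G where cont: "continuous_on UNIV G"
    and grad: "\<And>x. (f has_derivative (\<lambda>h. G x \<bullet> h)) (at x)"
    unfolding locally_operator_monotone_on_def C1_function_on_def by auto
  note line = affine_along_nonneg_direction[OF infinite_dimensional mono cont grad]
  have "0 \<le> G 0 $ i" for i
    using line(1)[of "axis i 1" 0] by (simp add: inner_axis) (simp add: axis_def)
  moreover have "f = (\<lambda>w. G 0 \<bullet> w + f 0)"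
    using affine_if_affine_along_nonneg_directions[of f G] line(2) by blast
  ultimately show "f \<in> {f. \<exists>(x :: real ^ 'n) (c :: real). (\<forall>i. 0 \<le> x $ i) \<and> f = (\<lambda>w. x \<bullet> w + c)}"
    by blast
next
  fix f :: "real ^ 'n \<Rightarrow> real"
  assume "f \<in> {f. \<exists>(x :: real ^ 'n) (c :: real). (\<forall>i. 0 \<le> x $ i) \<and> f = (\<lambda>w. x \<bullet> w + c)}"
  then show "f \<in> L_class TYPE('h) UNIV"
    unfolding L_class_def using affine_locally_operator_monotone by blast
qed

end
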